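(* Let $V,W\subset\mathbb{R}^n$ be open and $\Phi:V\to W$ a $C^{1,1}$ diffeomorphism. Let $\mathcal{X}\subset\mathbb{R}^n$ be locally compact and consider $\tilde{\mathcal{X}}:=\mathcal{X}\cap V$. If $\tilde{\mathcal{X}}$ is prox-regular, then $\Phi(\tilde{\mathcal{X}})$ is prox-regular.
   Context: A $C^{1,1}$ map is a $C^1$ map whose derivative is locally Lipschitz; a $C^{1,1}$ diffeomorphism is a $C^{1,1}$ bijection with $C^{1,1}$ inverse. A set is locally compact if it is the intersection of a closed and an open subset of $\mathbb{R}^n$. For $\mathcal{Y}\subset\mathbb{R}^n$ and $x\in\mathcal{Y}$: the tangent cone $T_x\mathcal{Y}$ is the set of all $v\in\mathbb{R}^n$ for which there exist $x_k\in\mathcal{Y}$, $x_k\to x$, and $\delta_k\to 0^+$ with $(x_k-x)/\delta_k\to v$. The Clarke tangent cone is $T^C_x\mathcal{Y}:=\liminf_{y\to x}T_y\mathcal{Y}$, i.e. the set of $v$ such that for every sequence $x_k\in\mathcal{Y}$, $x_k\to x$, there are (for all large $k$) $v_k\in T_{x_k}\mathcal{Y}$ with $v_k\to v$. $\mathcal{Y}$ is Clarke regular if it is locally compact and $T_x\mathcal{Y}=T_x^C\mathcal{Y}$ for all $x\in\mathcal{Y}$. Normal cone: $N_x\mathcal{Y}:=\{\eta\mid\langle v,\eta\rangle\le 0\ \forall v\in T_x^C\mathcal{Y}\}$. A Clarke regular set $\mathcal{Y}$ is prox-regular if for every $x\in\mathcal{Y}$ there is $L>0$ such that for all $z,y\in\mathcal{Y}$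 in a neighborhood of $x$ and all $\eta\in N_y\mathcal{Y}$ one has $\langle\eta,z-y\rangle\le L\|\eta\|\,\|z-y\|^2$. (This property does not depend on whether the Euclidean or another continuous metric is used.) *)

theory Defs
  imports "HOL-Analysis.Analysis"
begin

(* The derivative is taken in the normed space of bounded linear maps, so that continuity and the
   local Lipschitz property refer to the operator norm. The set S is meant to be open. *)
definition C11_on :: "(real ^ 'n) set \<Rightarrow> (real ^ 'n \<Rightarrow> real ^ 'n) \<Rightarrow> bool" where
  "C11_on S f \<longleftrightarrow>
     (\<exists>f' :: real ^ 'n \<Rightarrow> (real ^ 'n) \<Rightarrow>\<^sub>L (real ^ 'n).
        (\<forall>x\<in>S. (f has_derivative blinfun_apply (f' x)) (at x)) \<and>
        continuous_on S f' \<and>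
        (\<forall>x\<in>S. \<exists>r>0. \<exists>L. L-lipschitz_on (ball x r \<inter> S) f'))"

definition C11_diffeomorphism ::
    "(real ^ 'n) set \<Rightarrow> (real ^ 'n) set \<Rightarrow> (real ^ 'n \<Rightarrow> real ^ 'n) \<Rightarrow> bool" where
  "C11_diffeomorphism V W \<Phi> \<longleftrightarrow>
     bij_betw \<Phi> V W \<and> C11_on V \<Phi> \<and> C11_on W (inv_into V \<Phi>)"

definition loc_compact :: "(real ^ 'n) set \<Rightarrow> bool" where
  "loc_compact Y \<longleftrightarrow> (\<exists>C U. closed C \<and> open U \<and> Y = C \<inter> U)"

lemma loc_compact_iff_locally_compact: "loc_compact Y \<longleftrightarrow> locally compact Y"
  unfolding loc_compact_def by (rule locally_compact_closed_Int_open [symmetric])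

definition tangent_cone :: "(real ^ 'n) set \<Rightarrow> real ^ 'n \<Rightarrow> (real ^ 'n) set" where
  "tangent_cone Y x =
     {v. \<exists>(X :: nat \<Rightarrow> real ^ 'n) (\<delta> :: nat \<Rightarrow> real).
           (\<forall>k. X k \<in> Y) \<and> X \<longlonglongrightarrow> x \<and>
           (\<forall>k. \<delta> k > 0) \<and> \<delta> \<longlonglongrightarrow> 0 \<and>
           (\<lambda>k. (X k - x) /\<^sub>R \<delta> k) \<longlonglongrightarrow> v}"

definition clarke_tangent_cone :: "(real ^ 'n) set \<Rightarrow> real ^ 'n \<Rightarrow> (real ^ 'n) set" where
  "clarke_tangent_cone Y x =
     {v. \<forall>X :: nat \<Rightarrow> real ^ 'n. (\<forall>k. X k \<in> Y) \<and> X \<longlonglongrightarrow> x \<longrightarrow>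
           (\<exists>v' :: nat \<Rightarrow> real ^ 'n.
              (\<forall>\<^sub>F k in sequentially. v' k \<in> tangent_cone Y (X k)) \<and> v' \<longlonglongrightarrow> v)}"

definition clarke_regular :: "(real ^ 'n) set \<Rightarrow> bool" where
  "clarke_regular Y \<longleftrightarrow>
     loc_compact Y \<and> (\<forall>x\<in>Y. tangent_cone Y x = clarke_tangent_cone Y x)"

definition normal_cone :: "(real ^ 'n) set \<Rightarrow> real ^ 'n \<Rightarrow> (real ^ 'n) set" where
  "normal_cone Y x = {\<eta>. \<forall>v\<in>clarke_tangent_cone Y x. v \<bullet> \<eta> \<le> 0}"

definition prox_regular :: "(real ^ 'n) set \<Rightarrow> bool" where
  "prox_regular Y \<longleftrightarrow>
     clarke_regular Y \<and>
     (\<forall>x\<in>Y. \<exists>L>0. \<exists>U. open U \<and> x \<in> U \<and>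
        (\<forall>z\<in>Y \<inter> U. \<forall>y\<in>Y \<inter> U. \<forall>\<eta>\<in>normal_cone Y y.
           \<eta> \<bullet> (z - y) \<le> L * norm \<eta> * (norm (z - y))\<^sup>2))"

end

theory Submission
  imports Defs
begin

text \<open>
  The derivative of \<open>\<Phi>\<close> maps tangent cones onto tangent cones, and since it is continuous in the
  base point it also maps Clarke tangent cones onto Clarke tangent cones; hence Clarke regularity
  is preserved, and the adjoint of the derivative pulls normal vectors of the image back to normal
  vectors of the original set. In the prox-inequality for the image, \<open>\<Phi> z - \<Phi> y\<close> is replaced by its
  linearization at \<open>y\<close>: the error is quadratic because the derivative is Lipschitz, the linear part
  is controlled by the prox-inequality for the original set, and \<open>norm (z - y)\<close> is comparable to
  \<open>norm (\<Phi> z - \<Phi> y)\<close> because the inverse of \<open>\<Phi>\<close> is locally Lipschitz.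
\<close>

text \<open>The difference quotient of \<open>f\<close> along \<open>X\<close> is \<open>f'\<close>
  of the quotient \<open>(X k - x) /\<^sub>R \<delta> k\<close> plus the norm of that quotient times
  the normalized remainder \<open>R (X k)\<close>. The norms converge and the remainders vanish, so
  only \<open>f' v\<close> survives in the limit.\<close>

lemma tangent_cone_image:
  fixes f :: "real ^ 'n \<Rightarrow> real ^ 'n"
  assumes f: "(f has_derivative f') (at x)" and v: "v \<in> tangent_cone Y x"
  shows "f' v \<in> tangent_cone (f ` Y) (f x)"
proof -
  obtain X :: "nat \<Rightarrow> real ^ 'n" and \<delta> :: "nat \<Rightarrow> real"
    where X: "\<And>k. X k \<in> Y" "X \<longlonglongrightarrow> x" and \<delta>: "\<And>k. \<delta> k > 0" "\<delta> \<longlonglongrightarrow> 0"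
      and lim: "(\<lambda>k. (X k - x) /\<^sub>R \<delta> k) \<longlonglongrightarrow> v"
    using v unfolding tangent_cone_def by blast
  have bl: "bounded_linear f'"
    using f by (rule has_derivative_bounded_linear)
  define R where "R y = (f y - f x - f' (y - x)) /\<^sub>R norm (y - x)" for y
  have "(R \<longlongrightarrow> 0) (at x)"
    using f unfolding has_derivative_at_within R_def by (simp add: divide_inverse algebra_simps)
  \<comment> \<open>The inverse of 0 is 0, so \<open>R\<close> takes its limit value at
    \<open>x\<close> itself. This lets the sequence \<open>X\<close> return to
    \<open>x\<close>.\<close>
  moreover have "R x = 0"
    by (simp add: R_def)
  ultimately have "isCont R x"
    by (simp add: isCont_def)
  then have "(\<lambda>k. R (X k)) \<longlonglongrightarrow> 0"
    using isCont_tendsto_compose[OF _ X(2)] \<open>R x = 0\<close> by metis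
  then have "(\<lambda>k. f' ((X k - x) /\<^sub>R \<delta> k) + norm ((X k - x) /\<^sub>R \<delta> k) *\<^sub>R R (X k))
      \<longlonglongrightarrow> f' v + norm v *\<^sub>R 0"
    by (intro tendsto_intros bounded_linear.tendsto[OF bl] lim)
  moreover have "f' ((X k - x) /\<^sub>R \<delta> k) + norm ((X k - x) /\<^sub>R \<delta> k) *\<^sub>R R (X k)
      = (f (X k) - f x) /\<^sub>R \<delta> k" for k
  proof (cases "X k = x")
    case True
    then show ?thesis
      using bounded_linear.linear[OF bl] by (simp add: linear_0)
  next
    case False
    then have "norm ((X k - x) /\<^sub>R \<delta> k) *\<^sub>R R (X k)
        = (f (X k) - f x - f' (X k - x)) /\<^sub>R \<delta> k"
      using \<delta>(1)[of k] by (simp add: R_def)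
    moreover have "f' ((X k - x) /\<^sub>R \<delta> k) = f' (X k - x) /\<^sub>R \<delta> k"
      using bounded_linear.linear[OF bl] by (rule linear_scale)
    ultimately show ?thesis
      by (simp add: scaleR_diff_right)
  qed
  ultimately have "(\<lambda>k. (f (X k) - f x) /\<^sub>R \<delta> k) \<longlonglongrightarrow> f' v"
    by simp
  moreover have "(\<lambda>k. f (X k)) \<longlonglongrightarrow> f x"
    using has_derivative_continuous[OF f] X(2) by (rule isCont_tendsto_compose)
  ultimately show ?thesis
    unfolding tangent_cone_def using X(1) \<delta>
    by (intro CollectI exI[of _ "\<lambda>k. f (X k)"] exI[of _ \<delta>]) simp
qed

text \<open>A sequence in the image tending to \<open>f x\<close> is pulled back by \<open>g\<close>
  to a sequence in \<open>Y\<close> tending to \<open>x\<close>. The tangent vectors available there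
  are pushed forward by the derivatives at the moving base points, which converge in operator
  norm.\<close>

lemma clarke_tangent_cone_image:
  fixes f g :: "real ^ 'n \<Rightarrow> real ^ 'n"
    and f' :: "real ^ 'n \<Rightarrow> (real ^ 'n) \<Rightarrow>\<^sub>L (real ^ 'n)"
  assumes f: "\<And>y. y \<in> Y \<Longrightarrow> (f has_derivative f' y) (at y)" and f': "continuous_on Y f'"
    and g: "continuous_on (f ` Y) g" and gf: "\<And>y. y \<in> Y \<Longrightarrow> g (f y) = y"
    and x: "x \<in> Y" and v: "v \<in> clarke_tangent_cone Y x"
  shows "f' x v \<in> clarke_tangent_cone (f ` Y) (f x)"
  unfolding clarke_tangent_cone_def
proof (clarify)
  fix w :: "nat \<Rightarrow> real ^ 'n"
  assume w: "\<forall>k. w k \<in> f ` Y" and wlim: "w \<longlonglongrightarrow> f x"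
  have gw: "g (w k) \<in> Y" "f (g (w k)) = w k" for k
    using w gf by (metis imageE)+
  have "(\<lambda>k. g (w k)) \<longlonglongrightarrow> g (f x)"
    using continuous_on_tendsto_compose[OF g wlim] w x by simp
  then have glim: "(\<lambda>k. g (w k)) \<longlonglongrightarrow> x"
    using gf x by simp
  then have "\<exists>v'. (\<forall>\<^sub>F k in sequentially. v' k \<in> tangent_cone Y (g (w k))) \<and> v' \<longlonglongrightarrow> v"
    using v[unfolded clarke_tangent_cone_def, THEN CollectD, rule_format, of "\<lambda>k. g (w k)"] gw(1)
    by simp
  then obtain v' where ev: "\<forall>\<^sub>F k in sequentially. v' k \<in> tangent_cone Y (g (w k))"
    and v': "v' \<longlonglongrightarrow> v"
    by blast
  have "\<forall>\<^sub>F k in sequentially. f' (g (w k)) (v' k) \<in> tangent_cone (f ` Y) (w k)"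
    using ev by eventually_elim (metis tangent_cone_image f gw)
  moreover have "(\<lambda>k. f' (g (w k))) \<longlonglongrightarrow> f' x"
    using continuous_on_tendsto_compose[OF f' glim x] gw(1) by simp
  then have "(\<lambda>k. f' (g (w k)) (v' k)) \<longlonglongrightarrow> f' x v"
    using v' by (intro tendsto_intros)
  ultimately show "\<exists>v'. (\<forall>\<^sub>F k in sequentially. v' k \<in> tangent_cone (f ` Y) (w k))
      \<and> v' \<longlonglongrightarrow> f' x v"
    by (intro exI[of _ "\<lambda>k. f' (g (w k)) (v' k)"]) simp
qed

text \<open>Supplies one convex neighbourhood on which both mean value estimates below can run: the
  Lipschitz bound controls the linearization error, the norm bound makes the map itself
  Lipschitz.\<close>

lemma C11_on_derivative_Lipschitz_ball:
  fixes f' :: "real ^ 'n \<Rightarrow> (real ^ 'n) \<Rightarrow>\<^sub>L (real ^ 'n)"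
  assumes "open S" "x \<in> S" and lip: "\<forall>x\<in>S. \<exists>r>0. \<exists>L. L-lipschitz_on (ball x r \<inter> S) f'"
  obtains r M B where "r > 0" "ball x r \<subseteq> S" "M-lipschitz_on (ball x r) f'"
    "\<And>y. y \<in> ball x r \<Longrightarrow> norm (f' y) \<le> B" "B \<ge> 0"
proof -
  obtain r1 M where r1: "r1 > 0" "M-lipschitz_on (ball x r1 \<inter> S) f'"
    using lip \<open>x \<in> S\<close> by blast
  obtain r2 where r2: "r2 > 0" "ball x r2 \<subseteq> S"
    using assms(1,2) open_contains_ball by blast
  define r where "r = min r1 r2"
  have r: "r > 0" "ball x r \<subseteq> S" "M-lipschitz_on (ball x r) f'"
    using r1 r2 by (auto simp: r_def intro!: lipschitz_on_subset[OF r1(2)])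
  have M: "M \<ge> 0"
    using r(3) by (rule lipschitz_on_nonneg)
  have "norm (f' y) \<le> norm (f' x) + M * r" if y: "y \<in> ball x r" for y
  proof -
    have "norm (f' y - f' x) \<le> M * dist y x"
      using lipschitz_onD[OF r(3) y, of x] r(1) by (simp add: dist_norm)
    also have "\<dots> \<le> M * r"
      using y M by (intro mult_left_mono) (auto simp: dist_commute)
    finally show ?thesis
      using norm_triangle_sub[of "f' y" "f' x"] by linarith
  qed
  with r M that[of r M "norm (f' x) + M * r"] show thesis by simp
qed

text \<open>On the segment from \<open>y\<close> to \<open>z\<close> the derivative differs from
  \<open>f' y\<close> by at most \<open>M * norm (z - y)\<close>. The mean value inequality
  contributes the second factor \<open>norm (z - y)\<close>.\<close>

lemma linearization_error_le:
  fixes f' :: "real ^ 'n \<Rightarrow> (real ^ 'n) \<Rightarrow>\<^sub>L (real ^ 'n)"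
  assumes f: "\<And>y. y \<in> S \<Longrightarrow> (f has_derivative f' y) (at y)" and "convex S"
    and lip: "M-lipschitz_on S f'" and "y \<in> S" "z \<in> S"
  shows "norm (f z - f y - f' y (z - y)) \<le> M * (norm (z - y))\<^sup>2"
proof -
  have M: "M \<ge> 0"
    using lip by (rule lipschitz_on_nonneg)
  have seg: "closed_segment y z \<subseteq> S"
    using \<open>y \<in> S\<close> \<open>z \<in> S\<close> \<open>convex S\<close> by (rule closed_segment_subset)
  have "norm (f z - f y - f' y (z - y)) \<le> norm (z - y) * (M * norm (z - y))"
  proof (rule differentiable_bound_linearization[where S = "closed_segment y z"
        and f' = "\<lambda>x. blinfun_apply (f' x)"])
    show "y + t *\<^sub>R (z - y) \<in> closed_segment y z" if "t \<in> {0..1}" for t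
      using that by (auto simp: in_segment algebra_simps intro!: exI[of _ t])
    show "(f has_derivative f' x) (at x within closed_segment y z)" if "x \<in> closed_segment y z" for x
      using f that seg by (blast intro: has_derivative_at_withinI)
    show "onorm (blinfun_apply (f' x) - blinfun_apply (f' y)) \<le> M * norm (z - y)"
      if x: "x \<in> closed_segment y z" for x
    proof -
      have "norm (f' x - f' y) \<le> M * norm (x - y)"
        using lipschitz_onD[OF lip, of x y] x seg \<open>y \<in> S\<close> by (auto simp: dist_norm)
      also have "\<dots> \<le> M * norm (z - y)"
        using M segment_bound(1)[OF x] by (intro mult_left_mono)
      finally show ?thesis
        by (simp add: norm_blinfun.rep_eq minus_blinfun.rep_eq fun_diff_def)
    qed
  qed simp
  then show ?thesis
    by (simp add: power2_eq_square algebra_simps)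
qed

theorem proposition7p5:
  fixes V W X :: "(real ^ 'n) set" and \<Phi> :: "real ^ 'n \<Rightarrow> real ^ 'n"
  assumes "open V" and "open W"
    and "C11_diffeomorphism V W \<Phi>"
    and "loc_compact X"
    and "prox_regular (X \<inter> V)"
  shows "prox_regular (\<Phi> ` (X \<inter> V))"
proof -

  \<comment> \<open>The diffeomorphism, its inverse and their derivatives\<close>
  define \<Psi> where "\<Psi> = inv_into V \<Phi>"
  define Y where "Y = X \<inter> V"
  define Z where "Z = \<Phi> ` Y"
  have bij: "bij_betw \<Phi> V W" and "C11_on V \<Phi>" "C11_on W \<Psi>"
    using assms(3) by (auto simp: C11_diffeomorphism_def \<Psi>_def)
  obtain f' where f: "\<And>x. x \<in> V \<Longrightarrow> (\<Phi> has_derivative blinfun_apply (f' x)) (at x)"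
    and f': "continuous_on V f'"
    and f'_lip: "\<forall>x\<in>V. \<exists>r>0. \<exists>L. L-lipschitz_on (ball x r \<inter> V) f'"
    using \<open>C11_on V \<Phi>\<close> unfolding C11_on_def by blast
  obtain g' where g: "\<And>x. x \<in> W \<Longrightarrow> (\<Psi> has_derivative blinfun_apply (g' x)) (at x)"
    and g': "continuous_on W g'"
    and g'_lip: "\<forall>x\<in>W. \<exists>r>0. \<exists>L. L-lipschitz_on (ball x r \<inter> W) g'"
    using \<open>C11_on W \<Psi>\<close> unfolding C11_on_def by blast
  have gf: "\<Psi> (\<Phi> x) = x" if "x \<in> V" for x
    using bij that by (simp add: \<Psi>_def bij_betw_inv_into_left)
  have fg: "\<Phi> (\<Psi> w) = w" if "w \<in> W" for w
    using bij that by (simp add: \<Psi>_def bij_betw_inv_into_right)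
  have \<Phi>W: "\<Phi> x \<in> W" if "x \<in> V" for x
    using bij that by (rule bij_betwE[rule_format])
  have YV: "Y \<subseteq> V" and ZW: "Z \<subseteq> W" and \<Psi>Z: "\<Psi> ` Z = Y"
    using \<Phi>W gf by (auto simp: Y_def Z_def image_image)
  have cont_\<Phi>: "continuous_on V \<Phi>" and cont_\<Psi>: "continuous_on W \<Psi>"
    using f g by (meson has_derivative_continuous continuous_at_imp_continuous_on)+
  \<comment> \<open>This order of composition recovers a vector at \<open>\<Phi> x\<close> after
    pulling it back to \<open>x\<close> and pushing it forward again.\<close>
  have inverse: "f' x (g' (\<Phi> x) v) = v" if x: "x \<in> V" for x v
  proof -
    have "(\<Phi> \<circ> \<Psi> has_derivative blinfun_apply (f' x) \<circ> blinfun_apply (g' (\<Phi> x))) (at (\<Phi> x))"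
      using f[OF x] g[OF \<Phi>W[OF x]] gf[OF x] by (intro diff_chain_at) auto
    then have "(id has_derivative blinfun_apply (f' x) \<circ> blinfun_apply (g' (\<Phi> x))) (at (\<Phi> x))"
      by (rule has_derivative_transform_within_open[OF _ \<open>open W\<close> \<Phi>W[OF x]]) (simp add: fg)
    then have "blinfun_apply (f' x) \<circ> blinfun_apply (g' (\<Phi> x)) = id"
      using has_derivative_unique has_derivative_id by (metis id_def)
    then show ?thesis
      by (metis comp_apply id_apply)
  qed

  \<comment> \<open>Transport of both cones in both directions\<close>
  have T_push: "f' x v \<in> tangent_cone Z (\<Phi> x)" if "x \<in> Y" "v \<in> tangent_cone Y x" for x v
    unfolding Z_def using that YV f by (intro tangent_cone_image) auto
  have T_pull: "g' (\<Phi> x) v \<in> tangent_cone Y x"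
    if "x \<in> Y" "v \<in> tangent_cone Z (\<Phi> x)" for x v
    using tangent_cone_image[OF g[OF \<Phi>W] that(2)] that(1) YV gf \<Psi>Z by auto
  have C_push: "f' x v \<in> clarke_tangent_cone Z (\<Phi> x)"
    if "x \<in> Y" "v \<in> clarke_tangent_cone Y x" for x v
    unfolding Z_def
    by (rule clarke_tangent_cone_image[where g = \<Psi>])
      (use that YV ZW f gf in \<open>auto simp: Z_def intro: continuous_on_subset[OF f']
          continuous_on_subset[OF cont_\<Psi>]\<close>)
  have C_pull: "g' (\<Phi> x) v \<in> clarke_tangent_cone Y x"
    if x: "x \<in> Y" and v: "v \<in> clarke_tangent_cone Z (\<Phi> x)" for x v
  proof -
    have "g' (\<Phi> x) v \<in> clarke_tangent_cone (\<Psi> ` Z) (\<Psi> (\<Phi> x))"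
    proof (rule clarke_tangent_cone_image[where g = \<Phi>])
      show "continuous_on (\<Psi> ` Z) \<Phi>"
        using cont_\<Phi> YV \<Psi>Z continuous_on_subset by metis
    qed (use x v ZW g fg in \<open>auto simp: Z_def intro: continuous_on_subset[OF g']\<close>)
    then show ?thesis
      using x YV gf \<Psi>Z by auto
  qed

  \<comment> \<open>Clarke regularity of the image\<close>
  have reg_Y: "loc_compact Y" "\<And>x. x \<in> Y \<Longrightarrow> tangent_cone Y x = clarke_tangent_cone Y x"
    using assms(5) by (auto simp: Y_def prox_regular_def clarke_regular_def)
  \<comment> \<open>Being closed intersected with open amounts to topological local compactness,
    which homeomorphisms preserve.\<close>
  have "homeomorphism Y Z \<Phi> \<Psi>"
    unfolding homeomorphism_def
    using YV ZW \<Psi>Z gf fg cont_\<Phi> cont_\<Psi> by (auto simp: Z_def intro: continuous_on_subset)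
  then have "locally compact Z"
    using reg_Y(1) homeomorphic_local_compactness
    by (auto simp: loc_compact_iff_locally_compact homeomorphic_def)
  moreover have "tangent_cone Z (\<Phi> x) = clarke_tangent_cone Z (\<Phi> x)" if x: "x \<in> Y" for x
  proof (intro equalityI subsetI)
    fix v assume "v \<in> tangent_cone Z (\<Phi> x)"
    then show "v \<in> clarke_tangent_cone Z (\<Phi> x)"
      using C_push[OF x, of "g' (\<Phi> x) v"] T_pull[OF x] reg_Y(2)[OF x] inverse x YV by auto
  next
    fix v assume "v \<in> clarke_tangent_cone Z (\<Phi> x)"
    then show "v \<in> tangent_cone Z (\<Phi> x)"
      using T_push[OF x, of "g' (\<Phi> x) v"] C_pull[OF x] reg_Y(2)[OF x] inverse x YV by auto
  qed
  ultimately have "clarke_regular Z"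
    by (auto simp: clarke_regular_def loc_compact_iff_locally_compact Z_def)

  \<comment> \<open>The prox-inequality for the image\<close>
  moreover have "\<exists>L>0. \<exists>U. open U \<and> \<Phi> x \<in> U \<and>
      (\<forall>u\<in>Z \<inter> U. \<forall>w\<in>Z \<inter> U. \<forall>\<eta>\<in>normal_cone Z w.
         \<eta> \<bullet> (u - w) \<le> L * norm \<eta> * (norm (u - w))\<^sup>2)" if x: "x \<in> Y" for x
  proof -
    have xV: "x \<in> V" using x YV by blast
    have "\<exists>L>0. \<exists>U. open U \<and> x \<in> U \<and> (\<forall>z\<in>Y \<inter> U. \<forall>y\<in>Y \<inter> U. \<forall>\<zeta>\<in>normal_cone Y y.
        \<zeta> \<bullet> (z - y) \<le> L * norm \<zeta> * (norm (z - y))\<^sup>2)"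
      using assms(5) x by (simp add: prox_regular_def Y_def)
    then obtain L U where L: "L > 0" and U: "open U" "x \<in> U"
      and prox: "\<forall>z\<in>Y \<inter> U. \<forall>y\<in>Y \<inter> U. \<forall>\<zeta>\<in>normal_cone Y y.
        \<zeta> \<bullet> (z - y) \<le> L * norm \<zeta> * (norm (z - y))\<^sup>2"
      by (elim exE conjE)
    obtain r M B where r: "r > 0" "ball x r \<subseteq> V" "M-lipschitz_on (ball x r) f'"
      and B: "\<And>y. y \<in> ball x r \<Longrightarrow> norm (f' y) \<le> B" "B \<ge> 0"
      using C11_on_derivative_Lipschitz_ball[OF \<open>open V\<close> xV f'_lip] by blast
    obtain s K where s: "s > 0" "ball (\<Phi> x) s \<subseteq> W"
      and K: "\<And>w. w \<in> ball (\<Phi> x) s \<Longrightarrow> norm (g' w) \<le> K" "K \<ge> 0"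
      using C11_on_derivative_Lipschitz_ball[OF \<open>open W\<close> \<Phi>W[OF xV] g'_lip] by metis
    have M: "M \<ge> 0"
      using r(3) by (rule lipschitz_on_nonneg)
    \<comment> \<open>Points of \<open>U'\<close> lie in the ball where \<open>g'\<close> is bounded
      by \<open>K\<close>; their preimages lie in the ball where \<open>f'\<close> is controlled and
      in the neighbourhood \<open>U\<close> of the prox-inequality for \<open>Y\<close>.\<close>
    define U' where "U' = ball (\<Phi> x) s \<inter> \<Psi> -` (ball x r \<inter> U)"
    have "open U'"
      unfolding U'_def
      using continuous_on_subset[OF cont_\<Psi> s(2)] U(1) by (intro continuous_open_preimage) auto
    moreover have "\<Phi> x \<in> U'"
      using s(1) r(1) U(2) gf[OF xV] by (simp add: U'_def)
    \<comment> \<open>\<open>B\<close> comes from the norm of the adjoint, \<open>M\<close> from the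
      linearization error and \<open>K\<^sup>2\<close> from comparing \<open>z - y\<close> with
      \<open>u - w\<close>. The summand 1 keeps the constant positive even if
      \<open>K = 0\<close>.\<close>
    moreover have "\<eta> \<bullet> (u - w) \<le> ((L * B + M) * K\<^sup>2 + 1) * norm \<eta> * (norm (u - w))\<^sup>2"
      if u: "u \<in> Z \<inter> U'" and w: "w \<in> Z \<inter> U'" and \<eta>: "\<eta> \<in> normal_cone Z w" for u w \<eta>
    proof -
      define z y where "z = \<Psi> u" and "y = \<Psi> w"
      have uw: "u = \<Phi> z" "w = \<Phi> y"
        using u w ZW fg by (auto simp: z_def y_def)
      have zy: "z \<in> Y \<inter> U" "y \<in> Y \<inter> U" "z \<in> ball x r" "y \<in> ball x r"
        using u w \<Psi>Z by (auto simp: z_def y_def U'_def)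
      \<comment> \<open>Pairing \<open>v\<close> with \<open>\<zeta>\<close> is pairing
        \<open>f' y v\<close> with \<open>\<eta>\<close>. Since \<open>f' y\<close> maps the Clarke
        cone of \<open>Y\<close> into that of \<open>Z\<close>, \<open>\<zeta>\<close> is normal to
        \<open>Y\<close>.\<close>
      define \<zeta> where "\<zeta> = adjoint (blinfun_apply (f' y)) \<eta>"
      have adj: "v \<bullet> \<zeta> = f' y v \<bullet> \<eta>" for v
        unfolding \<zeta>_def by (intro adjoint_works bounded_linear.linear blinfun.bounded_linear_right)
      have "v \<bullet> \<zeta> \<le> 0" if "v \<in> clarke_tangent_cone Y y" for v
        using C_push[OF _ that] zy(2) \<eta> uw(2) adj by (auto simp: normal_cone_def)
      then have \<zeta>: "\<zeta> \<in> normal_cone Y y"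
        by (simp add: normal_cone_def)
      have norm_\<zeta>: "norm \<zeta> \<le> B * norm \<eta>"
      proof (cases "\<zeta> = 0")
        case False
        \<comment> \<open>Testing \<open>\<zeta>\<close> against itself leaves one factor
          \<open>norm \<zeta>\<close> to cancel.\<close>
        have "norm \<zeta> * norm \<zeta> = f' y \<zeta> \<bullet> \<eta>"
          using adj[of \<zeta>] by (simp add: dot_square_norm power2_eq_square)
        also have "\<dots> \<le> norm (f' y \<zeta>) * norm \<eta>"
          by (rule norm_cauchy_schwarz)
        also have "\<dots> \<le> (B * norm \<zeta>) * norm \<eta>"
          by (intro mult_right_mono order_trans[OF norm_blinfun] B(1)[OF zy(4)]) auto
        finally show ?thesis
          using False by (simp add: mult.commute mult.left_commute)
      qed (simp add: B(2))
      have "\<eta> \<bullet> (u - w) = \<zeta> \<bullet> (z - y) + \<eta> \<bullet> (\<Phi> z - \<Phi> y - f' y (z - y))"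
        using adj[of "z - y"] by (simp add: uw inner_commute inner_diff_right)
      also have "\<dots> \<le> L * norm \<zeta> * (norm (z - y))\<^sup>2
          + norm \<eta> * norm (\<Phi> z - \<Phi> y - f' y (z - y))"
        using prox[rule_format, OF zy(1,2) \<zeta>] by (intro add_mono norm_cauchy_schwarz)
      also have "\<dots> \<le> L * (B * norm \<eta>) * (norm (z - y))\<^sup>2
          + norm \<eta> * (M * (norm (z - y))\<^sup>2)"
        using norm_\<zeta> L f r zy(3,4)
        by (intro add_mono mult_right_mono mult_left_mono linearization_error_le[where S = "ball x r"])
          auto
      also have "\<dots> = (L * B + M) * norm \<eta> * (norm (z - y))\<^sup>2"
        by (simp add: algebra_simps)
      also have "\<dots> \<le> (L * B + M) * norm \<eta> * (K * norm (u - w))\<^sup>2"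
      proof (intro mult_left_mono power_mono)
        \<comment> \<open>Mean value inequality for \<open>\<Psi>\<close> on the convex ball around
          \<open>\<Phi> x\<close>.\<close>
        show "norm (z - y) \<le> K * norm (u - w)"
          unfolding z_def y_def
        proof (rule differentiable_bound[where S = "ball (\<Phi> x) s"])
          show "(\<Psi> has_derivative g' p) (at p within ball (\<Phi> x) s)" if "p \<in> ball (\<Phi> x) s" for p
            using that s(2) g by (blast intro: has_derivative_at_withinI)
          show "onorm (g' p) \<le> K" if "p \<in> ball (\<Phi> x) s" for p
            using K(1)[OF that] by (simp add: norm_blinfun.rep_eq)
        qed (use u w in \<open>auto simp: U'_def\<close>)
      qed (use L B(2) M in auto)
      also have "\<dots> \<le> ((L * B + M) * K\<^sup>2 + 1) * norm \<eta> * (norm (u - w))\<^sup>2"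
        by (simp add: power_mult_distrib algebra_simps)
      finally show ?thesis .
    qed
    moreover have "(L * B + M) * K\<^sup>2 + 1 > 0"
      using L B(2) M by (intro add_nonneg_pos mult_nonneg_nonneg) auto
    ultimately show ?thesis
      by (intro exI[of _ "(L * B + M) * K\<^sup>2 + 1"] exI[of _ U'] conjI ballI)
  qed
  ultimately show ?thesis
    unfolding prox_regular_def by (auto simp: Y_def Z_def)
qed

end
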